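(* Let $n\ge 4$ and let $\tilde Q_n$ be the switched $n$-cube (defined in the context). Then exactly half of the vertices of $\tilde Q_n$ pair up and have perfect state transfer between each other at time $\pi/2$; that is, the set of vertices $u$ of $\tilde Q_n$ for which there exists a vertex $v\neq u$ such that there is perfect state transfer between $u$ and $v$ at time $\pi/2$ has exactly $2^{n-1}$ elements.
   Context: For $m\ge 0$ let $C_m$ be the $2^m\times 2^m$ adjacency matrix of the $m$-cube with vertices labelled $1,\dots,2^m$, where $a$ and $b$ are adjacent iff the binary representations of $a-1$ and $b-1$ differ in exactly one bit ($C_0=[0]$). Let $I_{16}$ denote the $16\times 16$ identity matrix. The switched 4-cube $\tilde Q_4$ is the graph on vertices $\{1,\dots,16\}$ with the following 32 edges: $\{1,2\},\{1,3\},\{1,4\},\{1,5\}$; $\{2,8\},\{2,10\},\{2,11\},\{3,7\},\{3,9\},\{3,11\},\{4,6\},\{4,9\},\{4,10\},\{5,6\},\{5,7\},\{5,8\}$; $\{6,12\},\{6,13\},\{7,12\},\{7,14\},\{8,12\},\{8,15\},\{9,13\},\{9,14\},\{10,13\},\{10,15\},\{11,14\},\{11,15\}$; $\{12,16\},\{13,16\},\{14,16\},\{15,16\}$. Let $A_{4,2}$ be its adjacency matrix. For $n\ge 4$ the switched $n$-cube $\tilde Q_n=Q_{n-4}\square\tilde Q_4$ is the graph on vertices $\{1,\dots,2^n\}$ with adjacency matrix $C_{n-4}\otimes I_{16}+I_{2^{n-4}}\otimes A_{4,2}$. For a graph $G$ with adjacency matrix $A$ and vertices $j,k$, the fidelity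 of state transfer is $p_{j,k}(t)=|\langle j|e^{itA}|k\rangle|^2$, where $|j\rangle$ is the $j$-th standard basis vector; there is perfect state transfer (PST) between distinct vertices $j,k$ at time $t_0$ if $p_{j,k}(t_0)=1$. *)

theory Defs
  imports "HOL-Analysis.Analysis" "Jordan_Normal_Form.Matrix"
begin

text \<open>
  Matrices are those of \<^theory>\<open>Jordan_Normal_Form.Matrix\<close>, whose indices start at 0,
  while the vertices of a graph on \<open>N\<close> vertices are \<open>1, \<dots>, N\<close>:
  vertex \<open>j\<close> belongs to row and column \<open>j - 1\<close> of the adjacency matrix.
\<close>

definition kronecker_prod :: "'a :: semiring_1 mat \<Rightarrow> 'a mat \<Rightarrow> 'a mat" (infixl "\<otimes>\<^sub>m" 70) where
  "A \<otimes>\<^sub>m B = mat (dim_row A * dim_row B) (dim_col A * dim_col B)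
     (\<lambda>(i, j). A $$ (i div dim_row B, j div dim_col B) * B $$ (i mod dim_row B, j mod dim_col B))"

definition cube_mat :: "nat \<Rightarrow> complex mat" where
  "cube_mat m = mat (2 ^ m) (2 ^ m) (\<lambda>(i, j). of_bool (card {l. bit i l \<noteq> bit j l} = 1))"

definition switched_cube4_edges :: "nat set set" where
  "switched_cube4_edges =
    {{1,2}, {1,3}, {1,4}, {1,5},
     {2,8}, {2,10}, {2,11}, {3,7}, {3,9}, {3,11}, {4,6}, {4,9}, {4,10}, {5,6}, {5,7}, {5,8},
     {6,12}, {6,13}, {7,12}, {7,14}, {8,12}, {8,15}, {9,13}, {9,14}, {10,13}, {10,15},
     {11,14}, {11,15},
     {12,16}, {13,16}, {14,16}, {15,16}}"

definition switched_cube4_mat :: "complex mat" where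
  "switched_cube4_mat = mat 16 16 (\<lambda>(i, j). of_bool ({i + 1, j + 1} \<in> switched_cube4_edges))"

text \<open>Only meaningful for \<open>n \<ge> 4\<close>, because of the truncated subtraction.\<close>

definition switched_cube_mat :: "nat \<Rightarrow> complex mat" where
  "switched_cube_mat n =
     cube_mat (n - 4) \<otimes>\<^sub>m 1\<^sub>m 16 + 1\<^sub>m (2 ^ (n - 4)) \<otimes>\<^sub>m switched_cube4_mat"

text \<open>
  The type of matrices of arbitrary size carries no topology, so the exponential series of a
  square matrix is summed entrywise; by \<open>mat_exp_summable\<close> below it always converges.
\<close>

definition mat_exp :: "complex mat \<Rightarrow> complex mat" where
  "mat_exp A = mat (dim_row A) (dim_row A) (\<lambda>(i, j). \<Sum>k. (A ^\<^sub>m k) $$ (i, j) / fact k)"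

definition ket :: "nat \<Rightarrow> nat \<Rightarrow> complex vec" where
  "ket N j = unit_vec N (j - 1)"

text \<open>
  The product \<open>v \<bullet>c w\<close> is conjugate-linear in its second argument \<open>w\<close>, so the matrix element
  of \<open>M\<close> with bra \<open>j\<close> and ket \<open>k\<close> is \<open>(M *\<^sub>v ket N k) \<bullet>c ket N j\<close>.
\<close>

definition fidelity :: "complex mat \<Rightarrow> nat \<Rightarrow> nat \<Rightarrow> real \<Rightarrow> real" where
  "fidelity A j k t =
     (cmod ((mat_exp ((\<i> * complex_of_real t) \<cdot>\<^sub>m A) *\<^sub>v ket (dim_row A) k)
              \<bullet>c ket (dim_row A) j))\<^sup>2"

definition perfect_state_transfer :: "complex mat \<Rightarrow> nat \<Rightarrow> nat \<Rightarrow> real \<Rightarrow> bool" where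
  "perfect_state_transfer A j k t \<longleftrightarrow>
     j \<in> {1..dim_row A} \<and> k \<in> {1..dim_row A} \<and> j \<noteq> k \<and> fidelity A j k t = 1"

lemma mat_exp_summable:
  fixes A :: "complex mat"
  assumes A: "A \<in> carrier_mat N N" and i: "i < N" and j: "j < N"
  shows "summable (\<lambda>k. (A ^\<^sub>m k) $$ (i, j) / fact k)"
proof -
  define b where "b = (\<Sum>p<N. \<Sum>q<N. cmod (A $$ (p, q)))"
  have b0: "b \<ge> 0" unfolding b_def by (intro sum_nonneg) auto
  have b: "cmod (A $$ (p, q)) \<le> b" if "p < N" "q < N" for p q
  proof -
    have "cmod (A $$ (p, q)) \<le> (\<Sum>q<N. cmod (A $$ (p, q)))"
      using that by (intro member_le_sum) auto
    also have "\<dots> \<le> b"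
      unfolding b_def using that
      by (intro member_le_sum[of p "{..<N}" "\<lambda>p. \<Sum>q<N. cmod (A $$ (p, q))"])
         (auto intro: sum_nonneg)
    finally show ?thesis .
  qed
  have car: "A ^\<^sub>m k \<in> carrier_mat N N" for k
    using A by (rule pow_carrier_mat)
  have bound: "cmod ((A ^\<^sub>m k) $$ (i, j)) \<le> (real N * b) ^ k" if "j < N" for k j
    using that
  proof (induction k arbitrary: j)
    case 0
    then show ?case using A i by (simp add: one_mat_def)
  next
    case (Suc k)
    have "(A ^\<^sub>m Suc k) $$ (i, j) = (\<Sum>l<N. (A ^\<^sub>m k) $$ (i, l) * A $$ (l, j))"
      using A i Suc.prems car[of k]
      by (simp add: scalar_prod_def lessThan_atLeast0)
    also have "cmod \<dots> \<le> (\<Sum>l<N. cmod ((A ^\<^sub>m k) $$ (i, l) * A $$ (l, j)))"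
      by (rule norm_sum)
    also have "\<dots> \<le> (\<Sum>l<N. (real N * b) ^ k * b)"
      using Suc b b0 by (intro sum_mono) (auto simp: norm_mult intro!: mult_mono)
    also have "\<dots> = (real N * b) ^ Suc k" by simp
    finally show ?case .
  qed
  have "summable (\<lambda>k. (real N * b) ^ k / fact k)"
    using summable_exp_generic[of "real N * b"] by (simp add: divide_inverse mult.commute)
  then show ?thesis
    by (rule summable_comparison_test')
       (use bound[OF j] in \<open>auto simp: norm_divide intro!: divide_right_mono\<close>)
qed

end

theory Submission
  imports Defs
begin

text \<open>
  The adjacency matrix is a Kronecker sum, so its exponential factors into those of the cube and of
  the switched 4-cube. At time \<open>\<pi>/2\<close> the cube factor is \<open>\<i>\<^sup>m\<close> times the antipodal permutation. The
  switched 4-cube has the eigenvalues \<open>0, \<plusminus>2, \<plusminus>4\<close> of the 4-cube, so its exponential is the real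
  matrix \<open>I - 2A\<^sup>2/3 + A\<^sup>4/24\<close>; exactly 8 of its rows have an entry of modulus 1, and in the other
  8 rows the nonzero entries are \<open>\<plusminus>1/2\<close>.
\<close>

section \<open>Matrix exponentials of Kronecker sums\<close>

lemma sum_div_mod:
  fixes F :: "nat \<Rightarrow> nat \<Rightarrow> 'a :: comm_monoid_add"
  shows "(\<Sum>r<p * q. F (r div q) (r mod q)) = (\<Sum>x<p. \<Sum>y<q. F x y)"
proof -
  have "(\<Sum>r<p * q. F (r div q) (r mod q)) =
      (\<Sum>x<p. \<Sum>r\<in>{x * q..<x * q + q}. F (r div q) (r mod q))"
    by (simp add: sum.nat_group)
  also have "\<dots> = (\<Sum>x<p. \<Sum>y<q. F x y)"
  proof (rule sum.cong[OF refl])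
    fix x
    have "(\<Sum>r\<in>{0 + x * q..<q + x * q}. F (r div q) (r mod q)) =
        (\<Sum>y\<in>{0..<q}. F ((y + x * q) div q) ((y + x * q) mod q))"
      by (rule sum.shift_bounds_nat_ivl)
    then show "(\<Sum>r\<in>{x * q..<x * q + q}. F (r div q) (r mod q)) = (\<Sum>y<q. F x y)"
      by (simp add: add.commute lessThan_atLeast0)
  qed
  finally show ?thesis .
qed

text \<open>Powers grow by a factor on the right, so the inductions on \<open>k\<close> below fix
  the row and generalise only the column.\<close>

lemma pow_mat_Suc_entry:
  assumes "A \<in> carrier_mat n n" "i < n" "j < n"
  shows "(A ^\<^sub>m Suc k) $$ (i, j) = (\<Sum>l<n. (A ^\<^sub>m k) $$ (i, l) * A $$ (l, j))"
proof -
  have "A ^\<^sub>m k \<in> carrier_mat n n" using assms(1) by (rule pow_carrier_mat)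
  with assms show ?thesis by (simp add: scalar_prod_def lessThan_atLeast0)
qed

lemma pow_mat_smult_entry:
  fixes A :: "'a :: comm_semiring_1 mat"
  assumes A: "A \<in> carrier_mat n n" and "i < n" "j < n"
  shows "((c \<cdot>\<^sub>m A) ^\<^sub>m k) $$ (i, j) = c ^ k * (A ^\<^sub>m k) $$ (i, j)"
  using \<open>j < n\<close>
proof (induction k arbitrary: j)
  case 0
  then show ?case using A \<open>i < n\<close> by simp
next
  case (Suc k)
  have "((c \<cdot>\<^sub>m A) ^\<^sub>m Suc k) $$ (i, j) = (\<Sum>l<n. (c ^ k * (A ^\<^sub>m k) $$ (i, l)) * (c * A $$ (l, j)))"
    using A \<open>i < n\<close> Suc by (subst pow_mat_Suc_entry[of _ n]) auto
  also have "\<dots> = c ^ Suc k * (\<Sum>l<n. (A ^\<^sub>m k) $$ (i, l) * A $$ (l, j))"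
    by (simp add: sum_distrib_left mult_ac)
  finally show ?case using A \<open>i < n\<close> Suc.prems by (simp only: pow_mat_Suc_entry)
qed

section \<open>Kronecker sums and their powers\<close>

text \<open>For adjacency matrices this is the adjacency matrix of the Cartesian product of the
  graphs. Index \<open>i\<close> encodes the pair of \<open>i div dim_row A\<close> (for
  \<open>B\<close>) and \<open>i mod dim_row A\<close> (for \<open>A\<close>).\<close>

definition kronecker_sum :: "complex mat \<Rightarrow> complex mat \<Rightarrow> complex mat" where
  "kronecker_sum B A = B \<otimes>\<^sub>m 1\<^sub>m (dim_row A) + 1\<^sub>m (dim_row B) \<otimes>\<^sub>m A"

lemma kronecker_sum_carrier [intro]:
  assumes "B \<in> carrier_mat p p" "A \<in> carrier_mat q q"
  shows "kronecker_sum B A \<in> carrier_mat (p * q) (p * q)"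
  using assms by (auto simp: kronecker_sum_def kronecker_prod_def)

lemma div_mod_less:
  fixes i :: nat
  assumes "i < p * q"
  shows "i div q < p" "i mod q < q"
proof -
  have "q > 0" using assms by (cases q) auto
  then show "i div q < p" "i mod q < q" using assms by (auto simp: less_mult_imp_div_less)
qed

lemma kronecker_sum_entry:
  assumes "B \<in> carrier_mat p p" "A \<in> carrier_mat q q" "i < p * q" "j < p * q"
  shows "kronecker_sum B A $$ (i, j) =
    B $$ (i div q, j div q) * of_bool (i mod q = j mod q) +
    of_bool (i div q = j div q) * A $$ (i mod q, j mod q)"
  using assms div_mod_less[OF assms(3)] div_mod_less[OF assms(4)]
  by (auto simp: kronecker_sum_def kronecker_prod_def)

lemma smult_kronecker_sum:
  assumes "B \<in> carrier_mat p p" "A \<in> carrier_mat q q"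
  shows "c \<cdot>\<^sub>m kronecker_sum B A = kronecker_sum (c \<cdot>\<^sub>m B) (c \<cdot>\<^sub>m A)"
proof -
  note K = kronecker_sum_carrier[OF assms]
  note cK = kronecker_sum_carrier[of "c \<cdot>\<^sub>m B" p "c \<cdot>\<^sub>m A" q]
  show ?thesis
  proof (rule eq_matI)
    fix i j assume "i < dim_row (kronecker_sum (c \<cdot>\<^sub>m B) (c \<cdot>\<^sub>m A))"
      "j < dim_col (kronecker_sum (c \<cdot>\<^sub>m B) (c \<cdot>\<^sub>m A))"
    then have ij: "i < p * q" "j < p * q" using cK assms by auto
    show "(c \<cdot>\<^sub>m kronecker_sum B A) $$ (i, j) = kronecker_sum (c \<cdot>\<^sub>m B) (c \<cdot>\<^sub>m A) $$ (i, j)"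
      using ij K assms div_mod_less[OF ij(1)] div_mod_less[OF ij(2)]
      by (simp add: kronecker_sum_entry[of _ p _ q] algebra_simps)
  qed (use K cK assms in auto)
qed

text \<open>
  The two summands of a Kronecker sum commute; dividing by factorials turns the binomial theorem
  for its powers into a Cauchy product.
\<close>

lemma kronecker_sum_pow_entry:
  assumes B: "B \<in> carrier_mat p p" and A: "A \<in> carrier_mat q q"
    and i: "i < p * q" and j: "j < p * q"
  shows "(kronecker_sum B A ^\<^sub>m k) $$ (i, j) / fact k =
    (\<Sum>l\<le>k. (B ^\<^sub>m l) $$ (i div q, j div q) / fact l *
           ((A ^\<^sub>m (k - l)) $$ (i mod q, j mod q) / fact (k - l)))"
  using j
proof (induction k arbitrary: j)
  case 0
  have "i = j \<longleftrightarrow> i div q = j div q \<and> i mod q = j mod q" by (metis div_mult_mod_eq)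
  then show ?case
    using A B i 0 kronecker_sum_carrier[OF B A] div_mod_less[OF i] div_mod_less[OF 0] by auto
next
  case (Suc k)
  \<comment> \<open>With the factorial built in, one more matrix factor turns the term of index
    \<open>l\<close> into \<open>Suc l\<close> times the next one.\<close>
  define \<beta> where "\<beta> l x = (B ^\<^sub>m l) $$ (i div q, x) / fact l" for l x
  define \<alpha> where "\<alpha> l y = (A ^\<^sub>m l) $$ (i mod q, y) / fact l" for l y
  let ?j1 = "j div q" and ?j2 = "j mod q"
  note i12 = div_mod_less[OF i] and j12 = div_mod_less[OF Suc.prems]
  have \<beta>_Suc: "(\<Sum>x<p. \<beta> l x * B $$ (x, ?j1)) = of_nat (Suc l) * \<beta> (Suc l) ?j1" for l
    unfolding \<beta>_def pow_mat_Suc_entry[OF B i12(1) j12(1)]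
    by (simp add: sum_divide_distrib[symmetric] del: of_nat_Suc)
  have \<alpha>_Suc: "(\<Sum>y<q. \<alpha> l y * A $$ (y, ?j2)) = of_nat (Suc l) * \<alpha> (Suc l) ?j2" for l
    unfolding \<alpha>_def pow_mat_Suc_entry[OF A i12(2) j12(2)]
    by (simp add: sum_divide_distrib[symmetric] del: of_nat_Suc)
  have "(kronecker_sum B A ^\<^sub>m Suc k) $$ (i, j) / fact k =
      (\<Sum>r<p * q. (kronecker_sum B A ^\<^sub>m k) $$ (i, r) / fact k * kronecker_sum B A $$ (r, j))"
    using pow_mat_Suc_entry[OF kronecker_sum_carrier[OF B A] i Suc.prems]
    by (simp add: sum_divide_distrib)
  also have "\<dots> = (\<Sum>r<p * q. (\<Sum>l\<le>k. \<beta> l (r div q) * \<alpha> (k - l) (r mod q)) *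
      (B $$ (r div q, ?j1) * of_bool (r mod q = ?j2) + of_bool (r div q = ?j1) * A $$ (r mod q, ?j2)))"
    by (intro sum.cong refl, subst Suc.IH)
       (use Suc.prems in \<open>auto simp: \<beta>_def \<alpha>_def kronecker_sum_entry[OF B A]\<close>)
  also have "\<dots> = (\<Sum>x<p. \<Sum>y<q. (\<Sum>l\<le>k. \<beta> l x * \<alpha> (k - l) y) *
      (B $$ (x, ?j1) * of_bool (y = ?j2) + of_bool (x = ?j1) * A $$ (y, ?j2)))"
    by (rule sum_div_mod)
  also have "\<dots> = (\<Sum>x<p. (\<Sum>l\<le>k. \<beta> l x * \<alpha> (k - l) ?j2) * B $$ (x, ?j1)) +
      (\<Sum>y<q. (\<Sum>l\<le>k. \<beta> l ?j1 * \<alpha> (k - l) y) * A $$ (y, ?j2))"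
  proof -
    have "(\<Sum>x<p. \<Sum>y<q. (\<Sum>l\<le>k. \<beta> l x * \<alpha> (k - l) y) * (of_bool (x = ?j1) * A $$ (y, ?j2))) =
        (\<Sum>y<q. \<Sum>x<p. (\<Sum>l\<le>k. \<beta> l x * \<alpha> (k - l) y) * A $$ (y, ?j2) * of_bool (x = ?j1))"
      by (subst sum.swap) (simp add: mult_ac)
    then show ?thesis
      using j12 by (simp add: distrib_left sum.distrib sum_mult_of_bool_eq mult.assoc[symmetric])
  qed
  also have "(\<Sum>x<p. (\<Sum>l\<le>k. \<beta> l x * \<alpha> (k - l) ?j2) * B $$ (x, ?j1)) =
      (\<Sum>l\<le>k. of_nat (Suc l) * \<beta> (Suc l) ?j1 * \<alpha> (k - l) ?j2)"
    unfolding \<beta>_Suc[symmetric] sum_distrib_right by (subst sum.swap) (simp add: mult_ac)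
  \<comment> \<open>Shift \<open>l\<close> by one; the new term \<open>l = 0\<close> vanishes
    through its weight \<open>of_nat l\<close>.\<close>
  also have "\<dots> = (\<Sum>l\<le>Suc k. of_nat l * \<beta> l ?j1 * \<alpha> (Suc k - l) ?j2)"
    by (subst sum.atMost_Suc_shift) simp
  also have "(\<Sum>y<q. (\<Sum>l\<le>k. \<beta> l ?j1 * \<alpha> (k - l) y) * A $$ (y, ?j2)) =
      (\<Sum>l\<le>k. \<beta> l ?j1 * (of_nat (Suc (k - l)) * \<alpha> (Suc (k - l)) ?j2))"
    unfolding \<alpha>_Suc[symmetric] sum_distrib_right sum_distrib_left
    by (subst sum.swap) (simp add: mult_ac)
  \<comment> \<open>The added term \<open>l = Suc k\<close> has weight 0.\<close>
  also have "\<dots> = (\<Sum>l\<le>Suc k. \<beta> l ?j1 * (of_nat (Suc k - l) * \<alpha> (Suc k - l) ?j2))"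
    by (simp only: sum.atMost_Suc diff_self_eq_0 of_nat_0 mult_zero_left mult_zero_right add_0_right)
       (simp add: Suc_diff_le del: of_nat_Suc)
  \<comment> \<open>The weights \<open>l\<close> and \<open>Suc k - l\<close> add up to the constant
    \<open>Suc k\<close>, the factor by which \<open>fact (Suc k)\<close> exceeds
    \<open>fact k\<close>. This takes the place of Pascal's rule.\<close>
  also have "(\<Sum>l\<le>Suc k. of_nat l * \<beta> l ?j1 * \<alpha> (Suc k - l) ?j2) + \<dots> =
      (\<Sum>l\<le>Suc k. of_nat (Suc k) * (\<beta> l ?j1 * \<alpha> (Suc k - l) ?j2))"
    unfolding sum.distrib[symmetric]
    by (intro sum.cong refl) (auto simp: of_nat_diff algebra_simps)
  finally have "(kronecker_sum B A ^\<^sub>m Suc k) $$ (i, j) / fact k =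
      of_nat (Suc k) * (\<Sum>l\<le>Suc k. \<beta> l ?j1 * \<alpha> (Suc k - l) ?j2)"
    by (simp only: sum_distrib_left)
  then have "(kronecker_sum B A ^\<^sub>m Suc k) $$ (i, j) / fact (Suc k) =
      (\<Sum>l\<le>Suc k. \<beta> l ?j1 * \<alpha> (Suc k - l) ?j2)"
    by (simp add: field_simps del: of_nat_Suc sum.atMost_Suc)
  then show ?case by (simp only: \<beta>_def \<alpha>_def)
qed

section \<open>From powers to exponentials\<close>

lemma mat_exp_sums:
  assumes "A \<in> carrier_mat N N" "i < N" "j < N"
  shows "(\<lambda>k. (A ^\<^sub>m k) $$ (i, j) / fact k) sums mat_exp A $$ (i, j)"
  using summable_sums[OF mat_exp_summable[OF assms]] assms by (simp add: mat_exp_def)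

text \<open>The exponential series of \<open>2 \<cdot>\<^sub>m A\<close> is the power series with
  these coefficients at the point 2; convergence there gives absolute convergence at 1. The Cauchy
  product needs this.\<close>

lemma mat_exp_abs_summable:
  fixes A :: "complex mat"
  assumes "A \<in> carrier_mat N N" "i < N" "j < N"
  shows "summable (\<lambda>k. norm ((A ^\<^sub>m k) $$ (i, j) / fact k))"
proof -
  have "summable (\<lambda>k. ((2 \<cdot>\<^sub>m A) ^\<^sub>m k) $$ (i, j) / fact k)"
    using assms by (intro mat_exp_summable[of _ N]) auto
  then have "summable (\<lambda>k. (A ^\<^sub>m k) $$ (i, j) / fact k * 2 ^ k)"
    by (simp add: pow_mat_smult_entry[OF assms] mult.commute)
  from powser_insidea[OF this, of 1] show ?thesis by simp
qed

text \<open>By \<open>kronecker_sum_pow_entry\<close> the series on the left is the Cauchy product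
  of the two on the right, so the exponential is the Kronecker product of the exponentials.\<close>

lemma mat_exp_kronecker_sum:
  assumes B: "B \<in> carrier_mat p p" and A: "A \<in> carrier_mat q q"
    and i: "i < p * q" and j: "j < p * q"
  shows "mat_exp (kronecker_sum B A) $$ (i, j) =
    mat_exp B $$ (i div q, j div q) * mat_exp A $$ (i mod q, j mod q)"
proof -
  let ?b = "\<lambda>l. (B ^\<^sub>m l) $$ (i div q, j div q) / fact l"
  let ?a = "\<lambda>l. (A ^\<^sub>m l) $$ (i mod q, j mod q) / fact l"
  note i12 = div_mod_less[OF i] and j12 = div_mod_less[OF j]
  have "(\<lambda>k. (kronecker_sum B A ^\<^sub>m k) $$ (i, j) / fact k) sums ((\<Sum>k. ?b k) * (\<Sum>k. ?a k))"
    unfolding kronecker_sum_pow_entry[OF assms]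
    by (intro Cauchy_product_sums mat_exp_abs_summable[OF B] mat_exp_abs_summable[OF A] i12 j12)
  with mat_exp_sums[OF kronecker_sum_carrier[OF B A] i j] show ?thesis
    unfolding sums_unique[OF mat_exp_sums[OF B i12(1) j12(1)], symmetric]
      sums_unique[OF mat_exp_sums[OF A i12(2) j12(2)], symmetric]
    by (rule sums_unique2)
qed

lemma mat_exp_smult_kronecker_sum:
  assumes "B \<in> carrier_mat p p" "A \<in> carrier_mat q q" "i < p * q" "j < p * q"
  shows "mat_exp (c \<cdot>\<^sub>m kronecker_sum B A) $$ (i, j) =
    mat_exp (c \<cdot>\<^sub>m B) $$ (i div q, j div q) * mat_exp (c \<cdot>\<^sub>m A) $$ (i mod q, j mod q)"
  unfolding smult_kronecker_sum[OF assms(1,2)]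
  using assms by (intro mat_exp_kronecker_sum) auto

text \<open>Being antipodal is a condition on quotient and remainder separately: \<open>s\<close> is
  a multiple of \<open>q\<close> strictly between 0 and \<open>2 * q\<close>, hence equal to
  \<open>q\<close>. It serves for \<open>q = 2\<close> in the cube and \<open>q = 16\<close> in the
  product.\<close>

lemma Suc_add_eq_mult_iff:
  fixes i j q t :: nat
  assumes "q > 0"
  shows "Suc (i + j) = t * q \<longleftrightarrow> Suc (i div q + j div q) = t \<and> Suc (i mod q + j mod q) = q"
proof
  define x s where "x = i div q + j div q" and "s = Suc (i mod q + j mod q)"
  have eq: "Suc (i + j) = x * q + s"
    using div_mult_mod_eq[of i q] div_mult_mod_eq[of j q]
    by (simp only: x_def s_def add_mult_distrib)
  have s: "0 < s" "s < 2 * q"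
    using mod_less_divisor[OF assms, of i] mod_less_divisor[OF assms, of j] unfolding s_def by linarith+
  show "Suc x = t \<and> s = q" if "Suc (i + j) = t * q"
  proof -
    have "x * q + s = t * q" using that eq by simp
    then have "q dvd s" by (metis dvd_add_right_iff dvd_triv_right)
    then obtain k where k: "s = q * k" ..
    have "0 < k" "k < 2" using s k by (auto intro: gr0I)
    then have "k = 1" by simp
    then have "s = q" using k by simp
    moreover from this have "Suc x * q = t * q" using \<open>x * q + s = t * q\<close> by simp
    ultimately show ?thesis using assms by (metis mult_cancel2 less_numeral_extra(3))
  qed
  show "Suc (i + j) = t * q" if "Suc x = t \<and> s = q"
    using eq that by auto
qed

section \<open>The cube at time \<open>\<pi> / 2\<close>\<close>

definition hamming :: "nat \<Rightarrow> nat \<Rightarrow> nat" where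
  "hamming i j = card {l. bit i l \<noteq> bit j l}"

text \<open>Guards against the convention that infinite sets have \<open>card\<close> 0. A set bit
  \<open>l\<close> of \<open>n\<close> forces 2^l \<le> n and so l < n.\<close>

lemma finite_bit_diff: "finite {l. bit (i :: nat) l \<noteq> bit (j :: nat) l}"
proof -
  have "l < n" if "bit n l" for n l :: nat
  proof (rule ccontr)
    assume "\<not> l < n"
    then have "n < 2 ^ l" by (meson leI le_less_trans less_exp)
    then show False using that by (simp add: bit_nat_def)
  qed
  then have "{l. bit i l \<noteq> bit j l} \<subseteq> {..<max i j}" by fastforce
  then show ?thesis by (rule finite_subset) simp
qed

lemma hamming_eq_0_iff: "hamming i j = 0 \<longleftrightarrow> i = j"
  unfolding hamming_def card_0_eq[OF finite_bit_diff] by (auto intro: bit_eqI)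

text \<open>Splits off bit 0; the remaining positions are those of the halves, shifted by
  \<open>Suc\<close>.\<close>

lemma hamming_div_2: "hamming i j = hamming (i div 2) (j div 2) + of_bool (i mod 2 \<noteq> j mod 2)"
proof -
  let ?D = "{l. bit (i div 2) l \<noteq> bit (j div 2) l}"
  have "{l. bit i l \<noteq> bit j l} = Suc ` ?D \<union> (if i mod 2 \<noteq> j mod 2 then {0} else {})"
  proof (rule Set.set_eqI)
    fix l
    show "l \<in> {l. bit i l \<noteq> bit j l} \<longleftrightarrow>
        l \<in> Suc ` ?D \<union> (if i mod 2 \<noteq> j mod 2 then {0} else {})"
      by (cases l) (auto simp: bit_Suc bit_0 odd_iff_mod_2_eq_one)
  qed
  moreover have "card (Suc ` ?D) = card ?D" by (simp only: card_image inj_Suc)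
  moreover have "finite (Suc ` ?D)" by (intro finite_imageI finite_bit_diff)
  ultimately show ?thesis
    by (simp only: hamming_def) (auto simp: card_insert_if)
qed

lemma cube_mat_carrier [intro, simp]: "cube_mat m \<in> carrier_mat (2 ^ m) (2 ^ m)"
  by (simp add: cube_mat_def)

lemma cube_mat_entry:
  assumes "i < 2 ^ m" "j < 2 ^ m"
  shows "cube_mat m $$ (i, j) = of_bool (hamming i j = 1)"
  using assms by (simp add: cube_mat_def hamming_def)

lemma cube_mat_1_entry:
  assumes "i < 2" "j < 2"
  shows "cube_mat 1 $$ (i, j) = of_bool (i \<noteq> j)"
  using assms hamming_eq_0_iff[of 0 0] by (subst cube_mat_entry) (auto simp: hamming_div_2[of i j])

text \<open>The (m+1)-cube is the Cartesian product of the m-cube with an edge, the edge carrying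
  the lowest bit: exactly one bit differs iff it is the lowest one or one of the others, but not
  both.\<close>

lemma cube_mat_Suc: "cube_mat (Suc m) = kronecker_sum (cube_mat m) (cube_mat 1)"
proof -
  have K: "kronecker_sum (cube_mat m) (cube_mat 1) \<in> carrier_mat (2 ^ m * 2 ^ 1) (2 ^ m * 2 ^ 1)"
    by (intro kronecker_sum_carrier cube_mat_carrier)
  show ?thesis
  proof (rule eq_matI)
    fix i j assume "i < dim_row (kronecker_sum (cube_mat m) (cube_mat 1))"
      "j < dim_col (kronecker_sum (cube_mat m) (cube_mat 1))"
    then have ij: "i < 2 ^ m * 2 ^ 1" "j < 2 ^ m * 2 ^ 1" using K by auto
    have "kronecker_sum (cube_mat m) (cube_mat 1) $$ (i, j) =
        cube_mat m $$ (i div 2, j div 2) * of_bool (i mod 2 = j mod 2) +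
        of_bool (i div 2 = j div 2) * of_bool (i mod 2 \<noteq> j mod 2)"
      using kronecker_sum_entry[OF cube_mat_carrier cube_mat_carrier ij]
      by (simp add: cube_mat_1_entry[unfolded One_nat_def])
    also have "\<dots> = cube_mat (Suc m) $$ (i, j)"
      using ij hamming_eq_0_iff[of "i div 2" "j div 2"]
      by (auto simp: cube_mat_entry hamming_div_2[of i j] less_mult_imp_div_less)
    finally show "cube_mat (Suc m) $$ (i, j) = kronecker_sum (cube_mat m) (cube_mat 1) $$ (i, j)" ..
  qed (use K in \<open>auto simp: cube_mat_def\<close>)
qed

lemma mat_exp_smult_sums:
  assumes "A \<in> carrier_mat N N" "i < N" "j < N"
  shows "(\<lambda>k. c ^ k * (A ^\<^sub>m k) $$ (i, j) / fact k) sums mat_exp (c \<cdot>\<^sub>m A) $$ (i, j)"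
  using mat_exp_sums[of "c \<cdot>\<^sub>m A" N i j] assms
  by (simp add: pow_mat_smult_entry[OF assms])

lemma complex_exp_sums: "(\<lambda>k. z ^ k / fact k) sums exp (z :: complex)"
  using exp_converges[of z] by (simp add: scaleR_conv_of_real divide_inverse mult.commute)

text \<open>\<open>cube_mat 1\<close> swaps two basis vectors, so its powers alternate between the
  identity and the swap.\<close>

lemma cube_mat_1_pow_entry:
  assumes "i < 2" "j < 2"
  shows "(cube_mat 1 ^\<^sub>m k) $$ (i, j) = of_bool (even (i + j + k))"
  using assms(2)
proof (induction k arbitrary: j)
  case 0
  then show ?case using assms(1) by (auto simp: cube_mat_def less_2_cases_iff)
next
  case (Suc k)
  have c: "cube_mat 1 \<in> carrier_mat 2 2" using cube_mat_carrier[of 1] by simp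
  have "(cube_mat 1 ^\<^sub>m Suc k) $$ (i, j) =
      (\<Sum>l<2. of_bool (even (i + l + k)) * of_bool (l \<noteq> j))"
    unfolding pow_mat_Suc_entry[OF c assms(1) Suc.prems]
    by (intro sum.cong refl) (simp only: lessThan_iff Suc.IH cube_mat_1_entry Suc.prems)
  also have "\<dots> = of_bool (even (i + 0 + k)) * of_bool (0 \<noteq> j) + of_bool (even (i + 1 + k)) * of_bool (1 \<noteq> j)"
    by (simp add: numeral_2_eq_2)
  also have "\<dots> = of_bool (even (i + j + Suc k))"
    using Suc.prems by (auto simp: less_2_cases_iff)
  finally show ?case .
qed

text \<open>The diagonal collects the even part cos(pi/2) = 0 of the exponential series, the
  off-diagonal the odd part i sin(pi/2) = i.\<close>

lemma mat_exp_cube_mat_1_entry: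
  assumes "i < 2" "j < 2"
  shows "mat_exp ((\<i> * complex_of_real (pi / 2)) \<cdot>\<^sub>m cube_mat 1) $$ (i, j) = \<i> * of_bool (i \<noteq> j)"
proof -
  let ?c = "\<i> * complex_of_real (pi / 2)"
  have e: "exp ?c = \<i>" using cis_conv_exp[of "pi / 2"] by simp
  have e': "exp (- ?c) = - \<i>" unfolding exp_minus e by simp
  have c: "cube_mat 1 \<in> carrier_mat 2 2" using cube_mat_carrier[of 1] by simp
  \<comment> \<open>Averaging with the sign \<open>(- 1) ^ (i + j)\<close> selects the terms in
    which \<open>k\<close> has the parity of \<open>i + j\<close>.\<close>
  have "(\<lambda>k. (?c ^ k / fact k + (- 1) ^ (i + j) * ((- ?c) ^ k / fact k)) / 2) sums
      ((exp ?c + (- 1) ^ (i + j) * exp (- ?c)) / 2)"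
    by (intro sums_divide sums_add sums_mult complex_exp_sums)
  moreover have "(?c ^ k / fact k + (- 1) ^ (i + j) * ((- ?c) ^ k / fact k)) / 2 =
      ?c ^ k * (cube_mat 1 ^\<^sub>m k) $$ (i, j) / fact k" for k
    unfolding cube_mat_1_pow_entry[OF assms] power_minus[of ?c k] by (auto simp: minus_one_power_iff)
  ultimately have "(\<lambda>k. ?c ^ k * (cube_mat 1 ^\<^sub>m k) $$ (i, j) / fact k) sums
      ((exp ?c + (- 1) ^ (i + j) * exp (- ?c)) / 2)" by (simp only:)
  with mat_exp_smult_sums[OF c assms]
  have "mat_exp (?c \<cdot>\<^sub>m cube_mat 1) $$ (i, j) = (exp ?c + (- 1) ^ (i + j) * exp (- ?c)) / 2"
    by (rule sums_unique2)
  also have "\<dots> = \<i> * of_bool (i \<noteq> j)"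
    unfolding e e' using assms by (auto simp: less_2_cases_iff)
  finally show ?thesis .
qed

text \<open>Induction on the dimension through \<open>cube_mat_Suc\<close>. Taking the modulus
  discards the phase i^m, which does not affect the fidelity.\<close>

lemma cmod_mat_exp_cube_mat:
  assumes "i < 2 ^ m" "j < 2 ^ m"
  shows "cmod (mat_exp ((\<i> * complex_of_real (pi / 2)) \<cdot>\<^sub>m cube_mat m) $$ (i, j)) =
    of_bool (Suc (i + j) = 2 ^ m)"
  using assms
proof (induction m arbitrary: i j)
  case 0
  let ?c = "\<i> * complex_of_real (pi / 2)"
  have car: "cube_mat 0 \<in> carrier_mat 1 1" using cube_mat_carrier[of 0] by simp
  \<comment> \<open>For the 1 by 1 zero matrix only the zeroth power contributes, so the exponential
    is 1.\<close>
  have "cube_mat 0 $$ (0, 0) = 0" by (simp add: cube_mat_entry hamming_eq_0_iff[THEN iffD2])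
  then have "(cube_mat 0 ^\<^sub>m k) $$ (0, 0) = of_bool (k = 0)" for k
    using car by (cases k) (simp_all add: pow_mat_Suc_entry[of _ 1] del: pow_mat.simps(2))
  then have "?c ^ k * (cube_mat 0 ^\<^sub>m k) $$ (0, 0) / fact k = (if k = 0 then 1 else 0)" for k
    by simp
  with mat_exp_smult_sums[OF car, of 0 0 ?c]
  have "(\<lambda>k. if k = 0 then 1 else 0) sums mat_exp (?c \<cdot>\<^sub>m cube_mat 0) $$ (0, 0)"
    by simp
  then have "mat_exp (?c \<cdot>\<^sub>m cube_mat 0) $$ (0, 0) = 1"
    using sums_single[of 0 "\<lambda>_. 1 :: complex"] by (rule sums_unique2)
  with 0 show ?case by simp
next
  case (Suc m)
  then have ij: "i < 2 ^ m * 2 ^ 1" "j < 2 ^ m * 2 ^ 1" by auto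
  have i2: "i div 2 < 2 ^ m" "i mod 2 < 2" "j div 2 < 2 ^ m" "j mod 2 < 2"
    using ij by (auto simp: less_mult_imp_div_less)
  let ?c = "\<i> * complex_of_real (pi / 2)"
  have "mat_exp (?c \<cdot>\<^sub>m cube_mat (Suc m)) $$ (i, j) =
      mat_exp (?c \<cdot>\<^sub>m cube_mat m) $$ (i div 2, j div 2) * (\<i> * of_bool (i mod 2 \<noteq> j mod 2))"
    using mat_exp_smult_kronecker_sum[OF cube_mat_carrier cube_mat_carrier ij]
    by (simp only: cube_mat_Suc[of m] mat_exp_cube_mat_1_entry[OF i2(2,4)] power_one_right)
  then have "cmod (mat_exp (?c \<cdot>\<^sub>m cube_mat (Suc m)) $$ (i, j)) =
      of_bool (Suc (i div 2 + j div 2) = 2 ^ m) * cmod (\<i> * of_bool (i mod 2 \<noteq> j mod 2))"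
    by (simp only: norm_mult Suc.IH[OF i2(1,3)])
  also have "\<dots> = of_bool (Suc (i div 2 + j div 2) = 2 ^ m \<and> i mod 2 \<noteq> j mod 2)"
    by (cases "i mod 2 = j mod 2") auto
  also have "Suc (i div 2 + j div 2) = 2 ^ m \<and> i mod 2 \<noteq> j mod 2 \<longleftrightarrow> Suc (i + j) = 2 ^ Suc m"
  proof -
    \<comment> \<open>Two binary digits differ iff they are complementary, which is the remainder
      condition of \<open>Suc_add_eq_mult_iff\<close> for base 2.\<close>
    have "Suc (i mod 2 + j mod 2) = 2 \<longleftrightarrow> i mod 2 \<noteq> j mod 2"
      by (cases "even i"; cases "even j") (simp_all add: even_iff_mod_2_eq_zero odd_iff_mod_2_eq_one)
    with Suc_add_eq_mult_iff[of 2 i j "2 ^ m"] show ?thesis by (simp add: mult.commute)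
  qed
  finally show ?case .
qed

section \<open>The switched 4-cube at time \<open>\<pi> / 2\<close>\<close>

text \<open>Row \<open>j\<close> lists the neighbours of vertex \<open>j + 1\<close>, shifted down by 1.\<close>

definition nbrs :: "nat list list" where
  "nbrs = [[1, 2, 3, 4],
    [0, 7, 9, 10], [0, 6, 8, 10], [0, 5, 8, 9], [0, 5, 6, 7],
    [3, 4, 11, 12], [2, 4, 11, 13], [1, 4, 11, 14], [2, 3, 12, 13], [1, 3, 12, 14], [1, 2, 13, 14],
    [5, 6, 7, 15], [5, 8, 9, 15], [6, 8, 10, 15], [7, 9, 10, 15],
    [11, 12, 13, 14]]"

lemma length_nbrs: "length nbrs = 16"
  by (simp add: nbrs_def)

definition walk_step :: "int list \<Rightarrow> int list" where
  "walk_step v = map (\<lambda>ns. \<Sum>l\<leftarrow>ns. v ! l) nbrs"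

text \<open>Row \<open>i\<close> of the \<open>k\<close>-th power as a list of integers, a form in
  which \<open>code_simp\<close> can evaluate the finite checks below.\<close>

definition walks :: "nat \<Rightarrow> nat \<Rightarrow> int list" where
  "walks i k = (walk_step ^^ k) (map (\<lambda>j. of_bool (i = j)) [0..<16])"

text \<open>Replaces unordered pairs by a list of ordered ones, which makes adjacency
  executable.\<close>

lemma switched_cube4_edges_iff:
  "{x, y} \<in> switched_cube4_edges \<longleftrightarrow>
    (let es = [(1,2), (1,3), (1,4), (1,5),
       (2,8), (2,10), (2,11), (3,7), (3,9), (3,11), (4,6), (4,9), (4,10), (5,6), (5,7), (5,8),
       (6,12), (6,13), (7,12), (7,14), (8,12), (8,15), (9,13), (9,14), (10,13), (10,15),
       (11,14), (11,15), (12,16), (13,16), (14,16), (15,16)]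
     in (x, y) \<in> set es \<or> (y, x) \<in> set es)"
  unfolding switched_cube4_edges_def Let_def by (simp add: doubleton_eq_iff) argo

lemma switched_cube4_mat_carrier [intro, simp]: "switched_cube4_mat \<in> carrier_mat 16 16"
  by (simp add: switched_cube4_mat_def)

lemma switched_cube4_mat_entry:
  assumes "i < 16" "j < 16"
  shows "switched_cube4_mat $$ (i, j) = of_bool (i \<in> set (nbrs ! j))"
proof -
  have "\<forall>i\<in>set [0..<16]. \<forall>j\<in>set [0..<16].
      {i + 1, j + 1} \<in> switched_cube4_edges \<longleftrightarrow> i \<in> set (nbrs ! j)"
    unfolding switched_cube4_edges_iff by code_simp
  with assms show ?thesis by (simp add: switched_cube4_mat_def)
qed

text \<open>Without repetitions, the list sums in \<open>walk_step\<close> are sums over neighbour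
  sets.\<close>

lemma nbrs_distinct:
  assumes "j < 16"
  shows "distinct (nbrs ! j)" "set (nbrs ! j) \<subseteq> {..<16}"
proof -
  have "\<forall>ns\<in>set nbrs. distinct ns \<and> (\<forall>l\<in>set ns. l < 16)" by code_simp
  moreover have "nbrs ! j \<in> set nbrs" using assms by (simp add: length_nbrs)
  ultimately show "distinct (nbrs ! j)" "set (nbrs ! j) \<subseteq> {..<16}" by auto
qed

lemma switched_cube4_pow_entry:
  assumes "i < 16" "j < 16"
  shows "(switched_cube4_mat ^\<^sub>m k) $$ (i, j) = of_int (walks i k ! j)"
  using assms(2)
proof (induction k arbitrary: j)
  case 0
  then show ?case using assms(1) by (simp add: walks_def switched_cube4_mat_def)
next
  case (Suc k)
  have "(switched_cube4_mat ^\<^sub>m Suc k) $$ (i, j) =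
      (\<Sum>l<16. of_int (walks i k ! l) * of_bool (l \<in> set (nbrs ! j)))"
    unfolding pow_mat_Suc_entry[OF switched_cube4_mat_carrier assms(1) Suc.prems]
    using Suc by (intro sum.cong refl) (simp add: switched_cube4_mat_entry)
  also have "\<dots> = (\<Sum>l\<in>set (nbrs ! j). of_int (walks i k ! l))"
    using nbrs_distinct(2)[OF Suc.prems] by (intro sum.mono_neutral_cong_right) auto
  also have "\<dots> = of_int (\<Sum>l\<leftarrow>nbrs ! j. walks i k ! l)"
    using nbrs_distinct(1)[OF Suc.prems] by (simp add: sum_list_distinct_conv_sum_set)
  also have "(\<Sum>l\<leftarrow>nbrs ! j. walks i k ! l) = walks i (Suc k) ! j"
    using Suc.prems by (simp add: walks_def walk_step_def length_nbrs)
  finally show ?case .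
qed

section \<open>Spectral data of the switched 4-cube\<close>

text \<open>Checks by evaluation that x(x^2 - 4)(x^2 - 16) = x^5 - 20x^3 + 64x annihilates the
  adjacency matrix.\<close>

lemma walks_minimal_polynomial:
  assumes "i < 16" "j < 16"
  shows "walks i 5 ! j + 64 * walks i 1 ! j = 20 * walks i 3 ! j"
proof -
  have "\<forall>i\<in>set [0..<16]. map2 (\<lambda>x y. x + 64 * y) (walks i 5) (walks i 1) = map ((*) 20) (walks i 3)"
    by code_simp
  then have "map2 (\<lambda>x y. x + 64 * y) (walks i 5) (walks i 1) ! j = map ((*) 20) (walks i 3) ! j"
    using assms by simp
  moreover have "length (walks i k) = 16" for k
    by (cases k) (auto simp: walks_def walk_step_def length_nbrs)
  ultimately show ?thesis using assms by simp
qed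

text \<open>The expression is 24 times an entry of the exponential, so absolute value 24 means
  modulus 1. The indices listed belong to vertices 1, 6 to 11 and 16, those at even distance from
  vertex 1.\<close>

lemma walks_antipode:
  assumes "i < 16" "j < 16"
  shows "\<bar>24 * walks i 0 ! j - 16 * walks i 2 ! j + walks i 4 ! j\<bar> = 24 \<longleftrightarrow>
    i + j = 15 \<and> i \<in> {0, 5, 6, 7, 8, 9, 10, 15}"
proof -
  have "\<forall>i\<in>set [0..<16]. let w0 = walks i 0; w2 = walks i 2; w4 = walks i 4 in \<forall>j\<in>set [0..<16].
      \<bar>24 * w0 ! j - 16 * w2 ! j + w4 ! j\<bar> = 24 \<longleftrightarrow>
      i + j = 15 \<and> i \<in> set [0, 5, 6, 7, 8, 9, 10, 15]"
    by code_simp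
  then show ?thesis using assms by (simp add: Let_def)
qed

text \<open>
  The characteristic roots of the recurrence are \<open>0, \<plusminus>2, \<plusminus>4\<close>, and
  \<open>\<lambda> \<mapsto> exp (\<i>\<pi>\<lambda>/2)\<close> agrees on them with the polynomial \<open>1 - 2\<lambda>\<^sup>2/3 + \<lambda>\<^sup>4/24\<close>.
\<close>

lemma recurrence_exp_sums:
  fixes a :: "nat \<Rightarrow> complex"
  assumes rec: "\<And>k. a (k + 5) + 64 * a (k + 1) = 20 * a (k + 3)"
  shows "(\<lambda>k. (\<i> * complex_of_real (pi / 2)) ^ k * a k / fact k) sums ((24 * a 0 - 16 * a 2 + a 4) / 24)"
proof -
  let ?c = "\<i> * complex_of_real (pi / 2)"
  \<comment> \<open>These solve \<open>a 2 = 32 * p + 8 * q\<close>,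
    \<open>a 4 = 512 * p + 32 * q\<close> and \<open>a 1 = 8 * r + 4 * s\<close>,
    \<open>a 3 = 128 * r + 16 * s\<close>: the even and odd parts of the closed form fitted to
    initial values.\<close>
  define p q r s where "p = (a 4 - 4 * a 2) / 384" and "q = (16 * a 2 - a 4) / 96"
    and "r = (a 3 - 4 * a 1) / 96" and "s = (16 * a 1 - a 3) / 48"
  note defs = p_def q_def r_def s_def
  \<comment> \<open>The characteristic root 0 contributes only at \<open>k = 0\<close>, hence the
    conditional; the recurrence never reaches back to that index.\<close>
  have a: "a k = (if k = 0 then a 0 - 2 * p - 2 * q else 0) +
      (p + r) * 4 ^ k + (p - r) * (- 4) ^ k + (q + s) * 2 ^ k + (q - s) * (- 2) ^ k" for k
  proof (induction k rule: less_induct)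
    case (less k)
    show ?case
    proof (cases "k < 5")
      case True
      then have "k = 0 \<or> k = 1 \<or> k = 2 \<or> k = 3 \<or> k = 4" by auto
      then show ?thesis by (elim disjE) (simp_all add: defs field_simps)
    next
      case False
      then obtain m where k: "k = m + 5" using le_Suc_ex[of 5 k] by (auto simp: add.commute)
      have "a k = 20 * a (m + 3) - 64 * a (m + 1)" using rec[of m] k by (simp add: algebra_simps)
      also have "a (m + 3) = (p + r) * 4 ^ (m + 3) + (p - r) * (- 4) ^ (m + 3) +
          (q + s) * 2 ^ (m + 3) + (q - s) * (- 2) ^ (m + 3)"
        using less.IH[of "m + 3"] k by simp
      also have "a (m + 1) = (p + r) * 4 ^ (m + 1) + (p - r) * (- 4) ^ (m + 1) +
          (q + s) * 2 ^ (m + 1) + (q - s) * (- 2) ^ (m + 1)"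
        using less.IH[of "m + 1"] k by simp
      finally have "a k = (p + r) * 4 ^ k + (p - r) * (- 4) ^ k + (q + s) * 2 ^ k + (q - s) * (- 2) ^ k"
        unfolding k power_add by (simp add: algebra_simps)
      then show ?thesis using k by simp
    qed
  qed
  have e2: "exp (2 * ?c) = - 1" using exp_pi_i by (simp add: mult.commute)
  have e4: "exp (4 * ?c) = 1"
  proof -
    have "exp (4 * ?c) = exp (2 * ?c + 2 * ?c)" by (rule arg_cong[of _ _ exp]) simp
    then show ?thesis unfolding exp_add e2 by simp
  qed
  have e: "exp (- 4 * ?c) = 1" "exp (- 2 * ?c) = - 1"
    using e2 e4 exp_minus[of "2 * ?c"] exp_minus[of "4 * ?c"] by simp_all
  have "(\<lambda>k. (if k = 0 then a 0 - 2 * p - 2 * q else 0) +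
      (p + r) * ((4 * ?c) ^ k / fact k) + (p - r) * ((- 4 * ?c) ^ k / fact k) +
      (q + s) * ((2 * ?c) ^ k / fact k) + (q - s) * ((- 2 * ?c) ^ k / fact k)) sums
      ((a 0 - 2 * p - 2 * q) + (p + r) * exp (4 * ?c) + (p - r) * exp (- 4 * ?c) +
      (q + s) * exp (2 * ?c) + (q - s) * exp (- 2 * ?c))"
    using sums_single[of 0 "\<lambda>_. a 0 - 2 * p - 2 * q"]
    by (intro sums_add sums_mult complex_exp_sums) auto
  also have "(\<lambda>k. (if k = 0 then a 0 - 2 * p - 2 * q else 0) +
      (p + r) * ((4 * ?c) ^ k / fact k) + (p - r) * ((- 4 * ?c) ^ k / fact k) +
      (q + s) * ((2 * ?c) ^ k / fact k) + (q - s) * ((- 2 * ?c) ^ k / fact k)) =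
      (\<lambda>k. ?c ^ k * a k / fact k)"
  proof
    fix k
    show "(if k = 0 then a 0 - 2 * p - 2 * q else 0) +
      (p + r) * ((4 * ?c) ^ k / fact k) + (p - r) * ((- 4 * ?c) ^ k / fact k) +
      (q + s) * ((2 * ?c) ^ k / fact k) + (q - s) * ((- 2 * ?c) ^ k / fact k) = ?c ^ k * a k / fact k"
      unfolding power_mult_distrib
      by (subst a[of k]) (cases "k = 0"; simp add: distrib_left add_divide_distrib mult_ac)
  qed
  \<comment> \<open>The exponentials agree on opposite roots, so \<open>r\<close> and
    \<open>s\<close> cancel and \<open>a 0 - 4 * q\<close> remains.\<close>
  also have "(a 0 - 2 * p - 2 * q) + (p + r) * exp (4 * ?c) + (p - r) * exp (- 4 * ?c) +
      (q + s) * exp (2 * ?c) + (q - s) * exp (- 2 * ?c) = (24 * a 0 - 16 * a 2 + a 4) / 24"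
    unfolding e e2 e4 by (simp add: defs field_simps)
  finally show ?thesis .
qed

lemma cmod_mat_exp_switched_cube4_mat:
  assumes "i < 16" "j < 16"
  shows "cmod (mat_exp ((\<i> * complex_of_real (pi / 2)) \<cdot>\<^sub>m switched_cube4_mat) $$ (i, j)) = 1 \<longleftrightarrow>
    i + j = 15 \<and> i \<in> {0, 5, 6, 7, 8, 9, 10, 15}"
proof -
  let ?A = "switched_cube4_mat" and ?w = "\<lambda>k. walks i k ! j"
  \<comment> \<open>The evaluated identity is the case \<open>k = 0\<close>; multiplying by
    \<open>?A\<close> on the right raises all three exponents.\<close>
  have "(?A ^\<^sub>m (k + 5)) $$ (i, j) + 64 * (?A ^\<^sub>m (k + 1)) $$ (i, j) = 20 * (?A ^\<^sub>m (k + 3)) $$ (i, j)" for k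
    using assms(2)
  proof (induction k arbitrary: j)
    case 0
    have "complex_of_int (walks i 5 ! j + 64 * walks i 1 ! j) = of_int (20 * walks i 3 ! j)"
      using walks_minimal_polynomial[OF assms(1) 0] by (rule arg_cong)
    then show ?case
      unfolding add_0 switched_cube4_pow_entry[OF assms(1) 0] by simp
  next
    case (Suc k)
    note S = pow_mat_Suc_entry[OF switched_cube4_mat_carrier assms(1) Suc.prems]
    show ?case
      unfolding add_Suc S sum_distrib_left sum.distrib[symmetric]
    proof (rule sum.cong[OF refl])
      fix l :: nat assume "l \<in> {..<16}"
      then have "((?A ^\<^sub>m (k + 5)) $$ (i, l) + 64 * (?A ^\<^sub>m (k + 1)) $$ (i, l)) * ?A $$ (l, j) =
          20 * (?A ^\<^sub>m (k + 3)) $$ (i, l) * ?A $$ (l, j)"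
        using Suc.IH[of l] by simp
      then show "(?A ^\<^sub>m (k + 5)) $$ (i, l) * ?A $$ (l, j) + 64 * ((?A ^\<^sub>m (k + 1)) $$ (i, l) * ?A $$ (l, j)) =
          20 * ((?A ^\<^sub>m (k + 3)) $$ (i, l) * ?A $$ (l, j))"
        by (simp only: distrib_right mult.assoc)
    qed
  qed
  from mat_exp_smult_sums[OF switched_cube4_mat_carrier assms] recurrence_exp_sums[OF this]
  have "mat_exp ((\<i> * complex_of_real (pi / 2)) \<cdot>\<^sub>m ?A) $$ (i, j) =
      (24 * (?A ^\<^sub>m 0) $$ (i, j) - 16 * (?A ^\<^sub>m 2) $$ (i, j) + (?A ^\<^sub>m 4) $$ (i, j)) / 24"
    by (rule sums_unique2)
  \<comment> \<open>The entry is real, so its modulus is an absolute value of integers over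
    24.\<close>
  also have "\<dots> = complex_of_real (of_int (24 * ?w 0 - 16 * ?w 2 + ?w 4) / 24)"
    unfolding switched_cube4_pow_entry[OF assms] by simp
  finally have "cmod (mat_exp ((\<i> * complex_of_real (pi / 2)) \<cdot>\<^sub>m ?A) $$ (i, j)) =
      real_of_int \<bar>24 * ?w 0 - 16 * ?w 2 + ?w 4\<bar> / 24"
    by (simp only: norm_of_real abs_divide of_int_abs abs_numeral)
  moreover have "real_of_int z / 24 = 1 \<longleftrightarrow> z = 24" for z by auto
  ultimately show ?thesis using walks_antipode[OF assms] by (simp only:)
qed

section \<open>Counting the transferring vertices\<close>

text \<open>Unit vectors are real, so the conjugation in the inner product leaves them alone; the
  shift by 1 passes from vertices to indices.\<close>

lemma fidelity_eq_entry:
  assumes "A \<in> carrier_mat N N" "j \<in> {1..N}" "k \<in> {1..N}"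
  shows "fidelity A j k t = (cmod (mat_exp ((\<i> * complex_of_real t) \<cdot>\<^sub>m A) $$ (j - 1, k - 1)))\<^sup>2"
proof -
  let ?M = "mat_exp ((\<i> * complex_of_real t) \<cdot>\<^sub>m A)"
  have M: "?M \<in> carrier_mat N N" using assms(1) by (simp add: mat_exp_def)
  have jk: "j - 1 < N" "k - 1 < N" using assms by auto
  have "conjugate (unit_vec N (j - 1)) = (unit_vec N (j - 1) :: complex vec)"
    by (rule eq_vecI) (auto simp: unit_vec_def)
  then show ?thesis
    using assms(1) M jk by (simp add: fidelity_def ket_def)
qed

lemma switched_cube_mat_eq:
  "switched_cube_mat n = kronecker_sum (cube_mat (n - 4)) switched_cube4_mat"
  by (simp add: switched_cube_mat_def kronecker_sum_def cube_mat_def switched_cube4_mat_def)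

text \<open>The cube factor has modulus 0 or 1, so the product has modulus 1 iff both factors do;
  the two antipodal conditions then recombine in base 16. Indices out of range make both sides
  false.\<close>

lemma perfect_state_transfer_switched_cube_iff:
  assumes "n \<ge> 4"
  shows "perfect_state_transfer (switched_cube_mat n) (Suc i) (Suc j) (pi / 2) \<longleftrightarrow>
    Suc (i + j) = 2 ^ n \<and> i mod 16 \<in> {0, 5, 6, 7, 8, 9, 10, 15}"
proof -
  obtain m where n: "n = m + 4" using le_Suc_ex[OF assms] by (auto simp: add.commute)
  let ?C = "switched_cube_mat n" and ?c = "\<i> * complex_of_real (pi / 2)"
  have C: "?C \<in> carrier_mat (2 ^ m * 16) (2 ^ m * 16)"
    unfolding switched_cube_mat_eq n by (intro kronecker_sum_carrier) auto
  have iff: "Suc (i + j) = 2 ^ n \<longleftrightarrow> Suc (i div 16 + j div 16) = 2 ^ m \<and> i mod 16 + j mod 16 = 15"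
  proof -
    have "Suc x = 16 \<longleftrightarrow> x = 15" for x by auto
    moreover have "(2 :: nat) ^ n = 2 ^ m * 16" by (simp add: n power_add)
    ultimately show ?thesis using Suc_add_eq_mult_iff[of 16 i j "2 ^ m"] by (simp only:)
  qed
  show ?thesis
  proof (cases "i < 2 ^ m * 16 \<and> j < 2 ^ m * 16")
    case True
    then have i: "i < 2 ^ m * 16" and j: "j < 2 ^ m * 16" by auto
    have "fidelity ?C (Suc i) (Suc j) (pi / 2) = (cmod (mat_exp (?c \<cdot>\<^sub>m ?C) $$ (i, j)))\<^sup>2"
      using fidelity_eq_entry[OF C, of "Suc i" "Suc j"] i j by simp
    also have "\<dots> = (of_bool (Suc (i div 16 + j div 16) = 2 ^ m) *
        cmod (mat_exp (?c \<cdot>\<^sub>m switched_cube4_mat) $$ (i mod 16, j mod 16)))\<^sup>2"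
      using mat_exp_smult_kronecker_sum[OF cube_mat_carrier switched_cube4_mat_carrier i j, of ?c]
        cmod_mat_exp_cube_mat[of "i div 16" m "j div 16"] div_mod_less[OF i] div_mod_less[OF j]
      by (simp add: switched_cube_mat_eq n norm_mult)
    also have "\<dots> = 1 \<longleftrightarrow> Suc (i div 16 + j div 16) = 2 ^ m \<and>
        cmod (mat_exp (?c \<cdot>\<^sub>m switched_cube4_mat) $$ (i mod 16, j mod 16)) = 1"
    proof -
      have "(of_bool b * x)\<^sup>2 = 1 \<longleftrightarrow> b \<and> x = 1" if "x \<ge> 0" for b and x :: real
        using that by (cases b) (auto simp: power2_eq_1_iff)
      then show ?thesis by (simp only: norm_ge_zero)
    qed
    also have "\<dots> \<longleftrightarrow> Suc (i + j) = 2 ^ n \<and> i mod 16 \<in> {0, 5, 6, 7, 8, 9, 10, 15}"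
      unfolding cmod_mat_exp_switched_cube4_mat[OF div_mod_less(2)[OF i] div_mod_less(2)[OF j]] iff
      by (simp only: conj_assoc)
    finally have "fidelity ?C (Suc i) (Suc j) (pi / 2) = 1 \<longleftrightarrow>
        Suc (i + j) = 2 ^ n \<and> i mod 16 \<in> {0, 5, 6, 7, 8, 9, 10, 15}" .
    \<comment> \<open>Parity: \<open>Suc (2 * i)\<close> is odd while 2^n is even.\<close>
    moreover have "i \<noteq> j" if "Suc (i + j) = 2 ^ n"
    proof
      assume "i = j"
      with that have "Suc (2 * i) = 2 * (2 ^ m * 8)" by (simp add: n power_add)
      then have "even (Suc (2 * i)) = even (2 * (2 ^ m * 8 :: nat))" by (rule arg_cong)
      then show False by simp
    qed
    moreover have "dim_row ?C = 2 ^ m * 16" using C by auto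
    moreover have "Suc i \<in> {1..2 ^ m * 16}" "Suc j \<in> {1..2 ^ m * 16}" using i j by auto
    ultimately show ?thesis
      unfolding perfect_state_transfer_def nat.inject by (simp only:) blast
  next
    case False
    have "\<not> perfect_state_transfer ?C (Suc i) (Suc j) (pi / 2)"
    proof
      assume "perfect_state_transfer ?C (Suc i) (Suc j) (pi / 2)"
      then have "Suc i \<le> dim_row ?C \<and> Suc j \<le> dim_row ?C"
        unfolding perfect_state_transfer_def atLeastAtMost_iff by blast
      moreover have "dim_row ?C = 2 ^ m * 16" using C by auto
      ultimately show False using False by simp
    qed
    moreover have "Suc (i + j) \<noteq> 2 ^ n"
    proof -
      have "(2 :: nat) ^ n = 2 ^ m * 16" by (simp add: n power_add)
      with False show ?thesis by linarith
    qed
    ultimately show ?thesis by blast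
  qed
qed

theorem theorem2:
  fixes n :: nat
  assumes "n \<ge> 4"
  shows "card {u \<in> {1..2 ^ n}. \<exists>v \<in> {1..2 ^ n}. v \<noteq> u \<and>
           perfect_state_transfer (switched_cube_mat n) u v (pi / 2)} = 2 ^ (n - 1)"
proof -
  define S where "S = {0, 5, 6, 7, 8, 9, 10, 15 :: nat}"
  let ?U = "{u \<in> {1..2 ^ n}. \<exists>v \<in> {1..2 ^ n}. v \<noteq> u \<and>
           perfect_state_transfer (switched_cube_mat n) u v (pi / 2)}"
  obtain m where n: "n = m + 4" using le_Suc_ex[OF assms] by (auto simp: add.commute)
  note pst = perfect_state_transfer_switched_cube_iff[OF assms, folded S_def]
  have "?U = Suc ` {i. i < 2 ^ m * 16 \<and> i mod 16 \<in> S}"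
  proof (intro equalityI subsetI)
    fix u assume "u \<in> ?U"
    then obtain v where uv: "u \<in> {1..2 ^ n}" "v \<in> {1..2 ^ n}"
      "perfect_state_transfer (switched_cube_mat n) u v (pi / 2)" by blast
    obtain i j where "u = Suc i" "v = Suc j" using uv(1,2) by (cases u; cases v) auto
    then show "u \<in> Suc ` {i. i < 2 ^ m * 16 \<and> i mod 16 \<in> S}"
      using uv pst by (auto simp: n power_add)
  next
    fix u assume "u \<in> Suc ` {i. i < 2 ^ m * 16 \<and> i mod 16 \<in> S}"
    then obtain i where u: "u = Suc i" and i: "i < 2 ^ n" "i mod 16 \<in> S"
      by (auto simp: n power_add)
    \<comment> \<open>The witness is the antipode of \<open>u\<close>, at index
      \<open>2 ^ n - 1 - i\<close>.\<close>
    then have "perfect_state_transfer (switched_cube_mat n) u (Suc (2 ^ n - 1 - i)) (pi / 2)"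
      unfolding u pst by simp
    moreover from this have "Suc (2 ^ n - 1 - i) \<noteq> u"
      by (auto simp: perfect_state_transfer_def)
    ultimately show "u \<in> ?U"
      using i u by (auto intro!: bexI[of _ "Suc (2 ^ n - 1 - i)"])
  qed
  then have "card ?U = card {i. i < 2 ^ m * 16 \<and> i mod 16 \<in> S}"
    by (simp only: card_image inj_Suc)
  also have "\<dots> = (\<Sum>i<2 ^ m * 16. of_bool (i mod 16 \<in> S))"
  proof -
    have "{i. i < 2 ^ m * 16 \<and> i mod 16 \<in> S} = {..<2 ^ m * 16} \<inter> {i. i mod 16 \<in> S}" by blast
    then show ?thesis by (simp only: sum_of_bool_eq finite_lessThan of_nat_id)
  qed
  \<comment> \<open>Each of the 2^m copies of the switched 4-cube contributes the 8 residues in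
    \<open>S\<close>.\<close>
  also have "\<dots> = (\<Sum>x<(2 :: nat) ^ m. \<Sum>y<16. of_bool (y \<in> S))"
    by (rule sum_div_mod)
  also have "(\<Sum>y<16. of_bool (y \<in> S)) = (8 :: nat)"
  proof -
    have "S \<subseteq> {..<16}" by (simp add: S_def)
    then have "{..<16} \<inter> S = S" by blast
    then have "(\<Sum>y<16. of_bool (y \<in> S)) = card S"
      by (simp only: sum_of_bool_eq finite_lessThan Collect_mem_eq of_nat_id)
    also have "card S = 8" by (simp add: S_def)
    finally show ?thesis .
  qed
  also have "(\<Sum>x<(2 :: nat) ^ m. 8 :: nat) = 2 ^ (m + 3)" by (simp add: power_add)
  also have "m + 3 = n - 1" by (simp add: n)
  finally show ?thesis .
qed

end
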